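(* Let $a_1,b_1,a_2,b_2$ be positive integers. If there exist an $(a_1,b_1)$-bounded 1-cross intersecting set pair system of size $m_1$ and an $(a_2,b_2)$-bounded 1-cross intersecting set pair system of size $m_2$, then there also exists an $(a_1+a_2,\,b_1+b_2)$-bounded 1-cross intersecting set pair system of size $m_1\cdot m_2$.
   Context: A cross intersecting set pair system (SPS) of size $m\ge 2$ consists of finite sets $A_1,\dots,A_m$ and $B_1,\dots,B_m$ such that $A_i\cap B_i=\emptyset$ for every $1\le i\le m$ and $A_i\cap B_j\neq\emptyset$ for all $1\le i\neq j\le m$. It is $(a,b)$-bounded if $|A_i|\le a$ and $|B_i|\le b$ for each $i$. It is 1-cross intersecting if $|A_i\cap B_j|=1$ for each $i\neq j$. *)

theory Defs
  imports Main
begin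

text \<open>
  A set pair system of size m is a pair of families indexed by \<open>1, \<dots>, m\<close>; the values of
  \<open>A\<close> and \<open>B\<close> at indices outside \<open>{1..m}\<close> are irrelevant.
\<close>

definition cross_intersecting_sps ::
  "nat \<Rightarrow> (nat \<Rightarrow> 'a set) \<Rightarrow> (nat \<Rightarrow> 'a set) \<Rightarrow> bool" where
  "cross_intersecting_sps m A B \<longleftrightarrow>
     m \<ge> 2 \<and>
     (\<forall>i\<in>{1..m}. finite (A i) \<and> finite (B i)) \<and>
     (\<forall>i\<in>{1..m}. A i \<inter> B i = {}) \<and>
     (\<forall>i\<in>{1..m}. \<forall>j\<in>{1..m}. i \<noteq> j \<longrightarrow> A i \<inter> B j \<noteq> {})"

definition bounded_sps ::
  "nat \<Rightarrow> nat \<Rightarrow> nat \<Rightarrow> (nat \<Rightarrow> 'a set) \<Rightarrow> (nat \<Rightarrow> 'a set) \<Rightarrow> bool" where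
  "bounded_sps a b m A B \<longleftrightarrow> (\<forall>i\<in>{1..m}. card (A i) \<le> a \<and> card (B i) \<le> b)"

definition one_cross_intersecting_sps ::
  "nat \<Rightarrow> (nat \<Rightarrow> 'a set) \<Rightarrow> (nat \<Rightarrow> 'a set) \<Rightarrow> bool" where
  "one_cross_intersecting_sps m A B \<longleftrightarrow>
     cross_intersecting_sps m A B \<and>
     (\<forall>i\<in>{1..m}. \<forall>j\<in>{1..m}. i \<noteq> j \<longrightarrow> card (A i \<inter> B j) = 1)"

end

theory Submission
  imports Defs
begin

text \<open>
  Attach to the set pair system \<open>(A1, B1)\<close> one private copy of \<open>(A2, B2)\<close> for each of its
  indices. The pair with index \<open>(i, j)\<close> is
  \<open>A1 i \<union> ({i} \<times> A2 j)\<close>, \<open>B1 i \<union> ({i} \<times> B2 j)\<close>, the two parts living on disjoint ground sets,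
  so cardinalities add up to at most \<open>a1 + a2\<close> and \<open>b1 + b2\<close>. Between the indices \<open>(i, j)\<close> and
  \<open>(i', j')\<close> at most one of the two parts contributes. If \<open>i \<noteq> i'\<close>, the copies \<open>i\<close> and \<open>i'\<close> are
  disjoint and the single common point comes from the first system; if \<open>i = i'\<close>, then
  \<open>A1 i \<inter> B1 i\<close> is empty and the intersection is that of \<open>A2 j\<close> and \<open>B2 j'\<close>, which has one point
  for \<open>j \<noteq> j'\<close> and none for \<open>j = j'\<close>. Taking the copies private is what matters: with one
  common copy, indices differing in both coordinates would meet in two points.

  What remains is bookkeeping: the pairs \<open>(i, j)\<close> are numbered by division with remainder, and
  the finitely many points in use are renamed to natural numbers.
\<close>

text \<open>
  Disjointness on the diagonal and single intersections off it are both statements about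
  \<open>card (A i \<inter> B j)\<close>, and cardinality is all that a renaming of points has to preserve.
\<close>

lemma one_cross_intersecting_sps_iff_card:
  "one_cross_intersecting_sps m A B \<longleftrightarrow>
     m \<ge> 2 \<and> (\<forall>i\<in>{1..m}. finite (A i) \<and> finite (B i)) \<and>
     (\<forall>i\<in>{1..m}. \<forall>j\<in>{1..m}. card (A i \<inter> B j) = (if i = j then 0 else 1))"
  (is "_ \<longleftrightarrow> ?R")
proof
  assume "one_cross_intersecting_sps m A B"
  then show ?R
    by (auto simp: one_cross_intersecting_sps_def cross_intersecting_sps_def)
next
  assume R: ?R
  have "A i \<inter> B i = {}" if "i \<in> {1..m}" for i
    using R that by (metis card_0_eq finite_Int)
  moreover have "A i \<inter> B j \<noteq> {}" if "i \<in> {1..m}" "j \<in> {1..m}" "i \<noteq> j" for i j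
    using R that by (metis card.empty zero_neq_one)
  ultimately show "one_cross_intersecting_sps m A B"
    using R unfolding one_cross_intersecting_sps_def cross_intersecting_sps_def by simp
qed

lemma sps_rename_points_to_nat:
  fixes A B :: "nat \<Rightarrow> 'c set"
  assumes sps: "one_cross_intersecting_sps m A B" and bd: "bounded_sps a b m A B"
  shows "\<exists>A' B' :: nat \<Rightarrow> nat set.
           one_cross_intersecting_sps m A' B' \<and> bounded_sps a b m A' B'"
proof -
  define U where "U = (\<Union>i\<in>{1..m}. A i \<union> B i)"
  have "finite U"
    using sps by (auto simp: U_def one_cross_intersecting_sps_iff_card)
  then obtain f :: "'c \<Rightarrow> nat" where f: "inj_on f U"
    using finite_imp_inj_to_nat_seg by metis
  have sub: "A i \<subseteq> U" "B i \<subseteq> U" if "i \<in> {1..m}" for i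
    using that by (auto simp: U_def)
  have card_image_U: "card (f ` X) = card X" if "X \<subseteq> U" for X
    using f that by (meson card_image inj_on_subset)
  have "card (f ` A i \<inter> f ` B j) = card (A i \<inter> B j)" if "i \<in> {1..m}" "j \<in> {1..m}" for i j
    using inj_on_image_Int[OF f sub(1)[OF that(1)] sub(2)[OF that(2)]]
      card_image_U[of "A i \<inter> B j"] sub[OF that(1)] by auto
  then have "one_cross_intersecting_sps m (\<lambda>i. f ` A i) (\<lambda>i. f ` B i)"
    using sps by (simp add: one_cross_intersecting_sps_iff_card)
  moreover have "bounded_sps a b m (\<lambda>i. f ` A i) (\<lambda>i. f ` B i)"
    using bd sub by (simp add: bounded_sps_def card_image_U)
  ultimately show ?thesis by blast
qed

definition attach_copy :: "'i \<Rightarrow> 'a set \<Rightarrow> 'b set \<Rightarrow> ('a + 'i \<times> 'b) set" where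
  "attach_copy i X Y = X <+> ({i} \<times> Y)"

lemma finite_attach_copy: "finite X \<Longrightarrow> finite Y \<Longrightarrow> finite (attach_copy i X Y)"
  by (simp add: attach_copy_def)

lemma card_attach_copy:
  "finite X \<Longrightarrow> finite Y \<Longrightarrow> card (attach_copy i X Y) = card X + card Y"
  by (simp add: attach_copy_def card_Plus card_cartesian_product)

lemma attach_copy_Int:
  "attach_copy i X Y \<inter> attach_copy i' X' Y' =
     attach_copy i (X \<inter> X') (if i = i' then Y \<inter> Y' else {})"
  by (auto simp: attach_copy_def)

lemma sps_product:
  fixes A1 B1 :: "nat \<Rightarrow> 'a set" and A2 B2 :: "nat \<Rightarrow> 'b set"
  assumes sps1: "one_cross_intersecting_sps m1 A1 B1" and bd1: "bounded_sps a1 b1 m1 A1 B1"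
    and sps2: "one_cross_intersecting_sps m2 A2 B2" and bd2: "bounded_sps a2 b2 m2 A2 B2"
  obtains A B :: "nat \<Rightarrow> ('a + nat \<times> 'b) set"
  where "one_cross_intersecting_sps (m1 * m2) A B"
    and "bounded_sps (a1 + a2) (b1 + b2) (m1 * m2) A B"
proof -
  \<comment> \<open>Indices start at \<open>1\<close>, hence the shifts around the division with remainder.\<close>
  define p where "p k = (k - 1) div m2 + 1" for k :: nat
  define q where "q k = (k - 1) mod m2 + 1" for k :: nat
  define A where "A k = attach_copy (p k) (A1 (p k)) (A2 (q k))" for k
  define B where "B k = attach_copy (p k) (B1 (p k)) (B2 (q k))" for k
  note card1 = sps1[unfolded one_cross_intersecting_sps_iff_card]
  note card2 = sps2[unfolded one_cross_intersecting_sps_iff_card]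
  have m1: "m1 \<ge> 2" and m2: "m2 \<ge> 2"
    using card1 card2 by auto
  have p: "p k \<in> {1..m1}" if "k \<in> {1..m1 * m2}" for k
  proof -
    have "k - 1 < m1 * m2"
      using that by auto
    then have "(k - 1) div m2 < m1"
      by (simp add: less_mult_imp_div_less)
    then show ?thesis
      by (simp add: p_def)
  qed
  have q: "q k \<in> {1..m2}" for k
    using m2 by (simp add: q_def Suc_leI)
  have pq_inj: "k = l"
    if kl: "k \<in> {1..m1 * m2}" "l \<in> {1..m1 * m2}" and eq: "p k = p l" "q k = q l" for k l
  proof -
    have "k - 1 = l - 1"
      using eq by (metis add_right_cancel div_mult_mod_eq p_def q_def)
    then show ?thesis
      using kl by auto
  qed
  have fin1: "finite (A1 (p k))" "finite (B1 (p k))" if "k \<in> {1..m1 * m2}" for k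
    using card1 p[OF that] by auto
  have fin2: "finite (A2 (q k))" "finite (B2 (q k))" for k
    using card2 q[of k] by auto
  have "card (A k \<inter> B l) = (if k = l then 0 else 1)"
    if kl: "k \<in> {1..m1 * m2}" "l \<in> {1..m1 * m2}" for k l
  proof -
    have "card (A k \<inter> B l) =
        card (A1 (p k) \<inter> B1 (p l)) + (if p k = p l then card (A2 (q k) \<inter> B2 (q l)) else 0)"
      using fin1[OF kl(1)] fin2 by (simp add: A_def B_def attach_copy_Int card_attach_copy)
    also have "\<dots> = (if p k = p l \<and> q k = q l then 0 else 1)"
      using card1 card2 p[OF kl(1)] p[OF kl(2)] q[of k] q[of l] by simp
    also have "\<dots> = (if k = l then 0 else 1)"
      using pq_inj[OF kl] by auto
    finally show ?thesis .
  qed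
  moreover have "m1 * m2 \<ge> 2"
    using mult_le_mono[OF m1 m2] by simp
  moreover have "finite (A k) \<and> finite (B k)" if "k \<in> {1..m1 * m2}" for k
    using fin1[OF that] fin2[of k] by (simp add: A_def B_def finite_attach_copy)
  ultimately have "one_cross_intersecting_sps (m1 * m2) A B"
    unfolding one_cross_intersecting_sps_iff_card by blast
  moreover have "bounded_sps (a1 + a2) (b1 + b2) (m1 * m2) A B"
    unfolding bounded_sps_def
  proof
    fix k assume k: "k \<in> {1..m1 * m2}"
    show "card (A k) \<le> a1 + a2 \<and> card (B k) \<le> b1 + b2"
      using bd1 bd2 p[OF k] q[of k] fin1[OF k] fin2[of k]
      by (simp add: A_def B_def card_attach_copy bounded_sps_def add_mono)
  qed
  ultimately show thesis
    by (rule that)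
qed

theorem proposition1p1:
  fixes a1 b1 a2 b2 m1 m2 :: nat
  assumes "a1 > 0" and "b1 > 0" and "a2 > 0" and "b2 > 0"
    and "\<exists>A B :: nat \<Rightarrow> 'a set.
           one_cross_intersecting_sps m1 A B \<and> bounded_sps a1 b1 m1 A B"
    and "\<exists>A B :: nat \<Rightarrow> 'b set.
           one_cross_intersecting_sps m2 A B \<and> bounded_sps a2 b2 m2 A B"
  shows "\<exists>A B :: nat \<Rightarrow> nat set.
           one_cross_intersecting_sps (m1 * m2) A B \<and>
           bounded_sps (a1 + a2) (b1 + b2) (m1 * m2) A B"
proof -
  obtain A1 B1 :: "nat \<Rightarrow> 'a set"
    where 1: "one_cross_intersecting_sps m1 A1 B1" "bounded_sps a1 b1 m1 A1 B1"
    using assms(5) by blast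
  obtain A2 B2 :: "nat \<Rightarrow> 'b set"
    where 2: "one_cross_intersecting_sps m2 A2 B2" "bounded_sps a2 b2 m2 A2 B2"
    using assms(6) by blast
  show ?thesis
    using sps_product[OF 1 2] sps_rename_points_to_nat by metis
qed

end
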